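(* Let $t(n)$ be the number of partitions $\lambda$ of $n$ with $\mathcal{O}(\lambda)\equiv\mathcal{O}(\lambda')\pmod 4$, and let $u(n)=p(n)-t(n)$, where $p(n)$ is the number of partitions of $n$. Then $t(n)$ equals the number of partitions of $n$ with an even number of even hooks, and $u(n)$ equals the number of partitions of $n$ with an odd number of even hooks.
   Context: For a partition $\lambda$, $\lambda'$ denotes its conjugate partition and $\mathcal{O}(\lambda)$ denotes the number of odd parts of $\lambda$. For a cell $(i,j)$ of the Young diagram of $\lambda$, its hook length is $\lambda_i-j+\lambda'_j-i+1$. An even hook is a cell whose hook length is even; the number of even hooks of $\lambda$ is the number of such cells. *)

theory Defs
  imports "HOL-Number_Theory.Cong"
begin

text \<open>A partition is the list of its parts in weakly decreasing order, without zeros.\<close>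

definition is_partition :: "nat list \<Rightarrow> bool" where
  "is_partition lam \<longleftrightarrow> sorted_wrt (\<ge>) lam \<and> (\<forall>x\<in>set lam. 0 < x)"

definition partitions :: "nat \<Rightarrow> nat list set" where
  "partitions n = {lam. is_partition lam \<and> sum_list lam = n}"

text \<open>Parts are indexed from 1, and are 0 beyond the length of the partition.\<close>

definition part :: "nat list \<Rightarrow> nat \<Rightarrow> nat" where
  "part lam i = (if 1 \<le> i \<and> i \<le> length lam then lam ! (i - 1) else 0)"

text \<open>The \<open>j\<close>-th part of the conjugate is the length of the \<open>j\<close>-th column of the Young diagram.\<close>

definition conjugate :: "nat list \<Rightarrow> nat list" where
  "conjugate lam = map (\<lambda>j. card {i \<in> {1..length lam}. j \<le> part lam i}) [1..<part lam 1 + 1]"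

definition odd_parts :: "nat list \<Rightarrow> nat" where
  "odd_parts lam = length (filter odd lam)"

definition cells :: "nat list \<Rightarrow> (nat \<times> nat) set" where
  "cells lam = {(i, j). 1 \<le> i \<and> i \<le> length lam \<and> 1 \<le> j \<and> j \<le> part lam i}"

text \<open>The subtractions do not truncate when \<open>(i, j)\<close> is a cell of \<open>lam\<close>.\<close>

definition hook_length :: "nat list \<Rightarrow> nat \<times> nat \<Rightarrow> nat" where
  "hook_length lam = (\<lambda>(i, j). (part lam i - j) + (part (conjugate lam) j - i) + 1)"

definition even_hooks :: "nat list \<Rightarrow> nat" where
  "even_hooks lam = card {c \<in> cells lam. even (hook_length lam c)}"

definition p_num :: "nat \<Rightarrow> nat" where
  "p_num n = card (partitions n)"

definition t_num :: "nat \<Rightarrow> nat" where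
  "t_num n = card {lam \<in> partitions n. [odd_parts lam = odd_parts (conjugate lam)] (mod 4)}"

text \<open>This subtraction does not truncate either, by \<open>t_num_le_p_num\<close> below.\<close>

definition u_num :: "nat \<Rightarrow> nat" where
  "u_num n = p_num n - t_num n"

lemma finite_partitions: "finite (partitions n)"
proof (rule finite_subset)
  have "length lam \<le> sum_list lam" if "\<forall>x\<in>set lam. 0 < x" for lam :: "nat list"
    using that by (induction lam) auto
  then show "partitions n \<subseteq> {lam. set lam \<subseteq> {..n} \<and> length lam \<le> n}"
    by (auto simp: partitions_def is_partition_def dest: member_le_sum_list)
  show "finite {lam. set lam \<subseteq> {..n} \<and> length lam \<le> n}"
    by (rule finite_lists_length_le) simp
qed

lemma t_num_le_p_num: "t_num n \<le> p_num n"
  unfolding t_num_def p_num_def by (rule card_mono[OF finite_partitions]) blast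

end

theory Submission
  imports Defs
begin

text \<open>
  The criterion holds partition by partition. Write \<open>a(c)\<close> and \<open>l(c)\<close> for the arm and the leg of a
  cell \<open>c\<close>; its hook length is \<open>a(c) + l(c) + 1\<close>, so the number of even hooks has the parity of
  \<open>A + L\<close>, where \<open>A\<close> and \<open>L\<close> are the total arm and the total leg. A row of length \<open>m\<close> contributes
  \<open>m (m - 1) / 2\<close> to \<open>A\<close>, and \<open>m (m - 1) + (m mod 2)\<close> is congruent to \<open>m\<close> modulo 4. Summing over the
  rows, \<open>2 A + O(\<lambda>)\<close> is congruent to \<open>|\<lambda>|\<close> modulo 4. The same argument for the columns shows that
  \<open>2 L + O(\<lambda>')\<close> is congruent to \<open>|\<lambda>|\<close>, so \<open>O(\<lambda>)\<close> and \<open>O(\<lambda>')\<close> agree modulo 4 iff \<open>A + L\<close> is even.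
\<close>

lemma cells_eq_Sigma: "cells lam = Sigma {1..length lam} (\<lambda>i. {1..part lam i})"
  by (auto simp: cells_def)

lemma finite_cells: "finite (cells lam)"
  by (simp add: cells_eq_Sigma)

text \<open>The summand sees a row only through its length, so the row index can be traded for the
  entries of the list; this makes induction on \<open>lam\<close> available.\<close>

lemma sum_cells:
  "(\<Sum>(i, j)\<in>cells lam. f (part lam i) j) = (\<Sum>x\<leftarrow>lam. \<Sum>j = 1..x. f x j)"
proof -
  have "(\<Sum>(i, j)\<in>cells lam. f (part lam i) j)
      = (\<Sum>i = 1..length lam. \<Sum>j = 1..part lam i. f (part lam i) j)"
    by (simp add: cells_eq_Sigma sum.Sigma)
  also have "\<dots> = (\<Sum>k<length lam. \<Sum>j = 1..lam ! k. f (lam ! k) j)"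
    by (rule sum.reindex_bij_witness[of _ Suc "\<lambda>i. i - 1"]) (auto simp: part_def)
  also have "\<dots> = (\<Sum>x\<leftarrow>lam. \<Sum>j = 1..x. f x j)"
    by (simp add: sum_list_sum_nth atLeast0LessThan)
  finally show ?thesis .
qed

lemma card_cells: "card (cells lam) = sum_list lam"
  using sum_cells[of "\<lambda>_ _. 1 :: nat" lam] by (simp add: case_prod_beta)

lemma double_cong_mod_4_iff: "[2 * a = 2 * b] (mod 4) \<longleftrightarrow> [a = b] (mod 2)"
  for a b :: nat
proof -
  have "2 * c mod 4 = 2 * (c mod 2)" for c :: nat
    using mult_mod_right[of 2 c 2] by simp
  then show ?thesis
    by (simp add: cong_def)
qed

lemma row_arms_mod_4: "[2 * (\<Sum>j = 1..x. x - j) + x mod 2 = x] (mod 4)"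
  for x :: nat
proof -
  have "(\<Sum>j = 1..x. x - j) = (\<Sum>j<x. j)"
    by (rule sum.reindex_bij_witness[of _ "\<lambda>j. x - j" "\<lambda>j. x - j"]) auto
  \<comment> \<open>Exactly \<open>x div 2\<close> of the numbers below \<open>x\<close> are
    odd.\<close>
  moreover have "even (\<Sum>j<x. j) \<longleftrightarrow> even (x div 2)"
    by (induction x) (auto simp: div_Suc mod2_eq_if)
  ultimately have "[(\<Sum>j = 1..x. x - j) = x div 2] (mod 2)"
    by (simp add: cong_def mod2_eq_if)
  then have "[2 * (\<Sum>j = 1..x. x - j) = 2 * (x div 2)] (mod 4)"
    by (simp add: double_cong_mod_4_iff)
  then have "[2 * (\<Sum>j = 1..x. x - j) + x mod 2 = 2 * (x div 2) + x mod 2] (mod 4)"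
    by (rule cong_add) simp
  then show ?thesis
    by simp
qed

lemma arms_mod_4:
  "[2 * (\<Sum>(i, j)\<in>cells lam. part lam i - j) + odd_parts lam = sum_list lam] (mod 4)"
proof -
  have "[2 * (\<Sum>x\<leftarrow>lam. \<Sum>j = 1..x. x - j) + odd_parts lam = sum_list lam] (mod 4)"
  proof (induction lam)
    case (Cons x lam)
    have "odd_parts (x # lam) = x mod 2 + odd_parts lam"
      by (simp add: odd_parts_def mod2_eq_if)
    with cong_add[OF row_arms_mod_4[of x] Cons] show ?case
      by (simp add: algebra_simps)
  qed (simp add: odd_parts_def)
  then show ?thesis
    by (simp only: sum_cells[of "(-)"])
qed

lemma card_odd_cong_sum:
  fixes f :: "'a \<Rightarrow> nat"
  assumes "finite A"
  shows "[card {x \<in> A. odd (f x)} = sum f A] (mod 2)"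
proof -
  have "card {x \<in> A. odd (f x)} = (\<Sum>x\<in>A. f x mod 2)"
    using assms by (simp add: mod2_eq_if sum.If_cases Int_def flip: of_bool_def)
  then show ?thesis
    by (simp add: cong_def mod_sum_eq)
qed

lemma part_antimono:
  assumes "is_partition lam" "1 \<le> i" "i \<le> k"
  shows "part lam k \<le> part lam i"
proof (cases "i < k \<and> k \<le> length lam")
  case True
  then have "lam ! (k - 1) \<le> lam ! (i - 1)"
    using assms by (intro sorted_wrt_nth_less[where P = "(\<ge>)"]) (auto simp: is_partition_def)
  with True assms show ?thesis
    by (simp add: part_def)
qed (use assms in \<open>auto simp: part_def\<close>)

lemma downward_closed_eq_atLeastAtMost_card:
  fixes S :: "nat set"
  assumes "finite S" "S \<subseteq> {1..}" and down: "\<And>i k. k \<in> S \<Longrightarrow> 1 \<le> i \<Longrightarrow> i \<le> k \<Longrightarrow> i \<in> S"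
  shows "S = {1..card S}"
proof (cases "S = {}")
  case False
  have "S = {1..Max S}"
    using assms False by (auto intro: down[OF Max_in])
  then show ?thesis
    by (metis card_atLeastAtMost diff_Suc_1)
qed simp

text \<open>Rows weakly decrease, so a column is an initial segment of the row indices, determined
  by its size. For \<open>j\<close> beyond the first row both sides are empty, by the default value
  0 of \<open>part\<close>.\<close>

lemma column_eq:
  assumes "is_partition lam" "1 \<le> j"
  shows "{i \<in> {1..length lam}. j \<le> part lam i} = {1..part (conjugate lam) j}"
proof -
  let ?S = "{i \<in> {1..length lam}. j \<le> part lam i}"
  have "i \<in> ?S" if "k \<in> ?S" "1 \<le> i" "i \<le> k" for i k
    using that part_antimono[OF assms(1) that(2,3)] by auto
  then have S: "?S = {1..card ?S}"
    by (intro downward_closed_eq_atLeastAtMost_card) auto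
  have "part (conjugate lam) j = card ?S"
  proof (cases "j \<le> part lam 1")
    case True
    with assms(2) have "[1..<part lam 1 + 1] ! (j - 1) = j"
      by (subst nth_upt) auto
    with True assms(2) show ?thesis
      unfolding part_def[of "conjugate lam"] by (simp add: conjugate_def del: upt_Suc)
  next
    case False
    then have "?S = {}"
      using part_antimono[OF assms(1), of 1] by fastforce
    with False show ?thesis
      unfolding part_def[of "conjugate lam"] by (simp add: conjugate_def del: upt_Suc)
  qed
  with S show ?thesis
    by simp
qed

lemma cells_conjugate:
  assumes "is_partition lam"
  shows "cells (conjugate lam) = prod.swap ` cells lam"
proof -
  have "(j, i) \<in> cells (conjugate lam) \<longleftrightarrow> (i, j) \<in> cells lam" for i j
  proof (cases "1 \<le> j")
    case True
    have "(j, i) \<in> cells (conjugate lam) \<longleftrightarrow> i \<in> {1..part (conjugate lam) j}"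
      \<comment> \<open>An \<open>i\<close> with \<open>1 \<le> i\<close> below
        \<open>part (conjugate lam) j\<close> forces \<open>j\<close> to index an actual part, since
        \<open>part\<close> is 0 past the end.\<close>
      using True by (auto simp: cells_def part_def[of "conjugate lam"] split: if_splits)
    also have "\<dots> \<longleftrightarrow> (i, j) \<in> cells lam"
      unfolding column_eq[OF assms True, symmetric] using True by (auto simp: cells_def)
    finally show ?thesis .
  qed (auto simp: cells_def)
  then show ?thesis
    by (force simp: image_iff)
qed

text \<open>Both sides count cells, and swapping coordinates is injective.\<close>

lemma sum_list_conjugate:
  assumes "is_partition lam"
  shows "sum_list (conjugate lam) = sum_list lam"
  by (simp add: card_image cells_conjugate[OF assms] flip: card_cells)

text \<open>Swapping coordinates turns the legs of \<open>lam\<close> into the arms of its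
  conjugate, which has the same size.\<close>

lemma legs_mod_4:
  assumes "is_partition lam"
  shows "[2 * (\<Sum>(i, j)\<in>cells lam. part (conjugate lam) j - i) + odd_parts (conjugate lam)
          = sum_list lam] (mod 4)"
  using arms_mod_4[of "conjugate lam"]
  by (simp add: sum_list_conjugate[OF assms] cells_conjugate[OF assms] sum.reindex case_prod_beta)

lemma odd_parts_cong_iff_even_hooks:
  assumes "is_partition lam"
  shows "[odd_parts lam = odd_parts (conjugate lam)] (mod 4) \<longleftrightarrow> even (even_hooks lam)"
proof -
  let ?A = "\<Sum>(i, j)\<in>cells lam. part lam i - j"
  let ?L = "\<Sum>(i, j)\<in>cells lam. part (conjugate lam) j - i"
  let ?f = "\<lambda>(i, j). (part lam i - j) + (part (conjugate lam) j - i)"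
  \<comment> \<open>The hook length exceeds arm plus leg by 1, which flips the parity.\<close>
  have "even_hooks lam = card {c \<in> cells lam. odd (?f c)}"
    by (simp add: even_hooks_def hook_length_def case_prod_beta)
  moreover have "(\<Sum>c\<in>cells lam. ?f c) = ?A + ?L"
    by (simp add: case_prod_beta sum.distrib)
  ultimately have "[even_hooks lam = ?A + ?L] (mod 2)"
    using card_odd_cong_sum[OF finite_cells, of lam ?f] by simp
  then have "even (even_hooks lam) \<longleftrightarrow> [?A = ?L] (mod 2)"
    by (auto simp: cong_def mod2_eq_if split: if_splits)
  also have "\<dots> \<longleftrightarrow> [2 * ?A = 2 * ?L] (mod 4)"
    by (simp add: double_cong_mod_4_iff)
  also have "\<dots> \<longleftrightarrow> [odd_parts lam = odd_parts (conjugate lam)] (mod 4)"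
  proof -
    \<comment> \<open>Both sides are congruent to \<open>sum_list lam\<close>; cancelling either
      pair of congruent summands leaves the other pair congruent.\<close>
    have "[2 * ?A + odd_parts lam = 2 * ?L + odd_parts (conjugate lam)] (mod 4)"
      using arms_mod_4 legs_mod_4[OF assms] by (blast intro: cong_trans cong_sym)
    then show ?thesis
      by (meson cong_add cong_add_lcancel_nat cong_add_rcancel_nat cong_refl cong_sym cong_trans)
  qed
  finally show ?thesis
    by blast
qed

theorem theorem3p2:
  fixes n :: nat
  shows "t_num n = card {lam \<in> partitions n. even (even_hooks lam)} \<and>
         u_num n = card {lam \<in> partitions n. odd (even_hooks lam)}"
proof
  let ?E = "{lam \<in> partitions n. even (even_hooks lam)}"
  have "{lam \<in> partitions n. [odd_parts lam = odd_parts (conjugate lam)] (mod 4)} = ?E"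
    by (auto simp: partitions_def odd_parts_cong_iff_even_hooks)
  then show t: "t_num n = card ?E"
    by (simp add: t_num_def)
  have "{lam \<in> partitions n. odd (even_hooks lam)} = partitions n - ?E"
    by auto
  then show "u_num n = card {lam \<in> partitions n. odd (even_hooks lam)}"
    by (simp add: u_num_def p_num_def t card_Diff_subset finite_partitions)
qed

end
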